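(* Let $(X_k)_{k\in\mathbb{Z}}$ be an $L_2$-stationary sequence of square-integrable real random variables, standardized so that $E(X_k)=0$ and $E(X_k^2)=1$ for all $k$. Let $r_k=\mathrm{corr}(X_0,X_k)$ for $k\in\mathbb{Z}$ and $\rho=r_1$. Suppose that there are real constants $a,b$ such that for all $k\in\mathbb{Z}$ $$E(X_k\mid \dots,X_{k-2},X_{k-1},X_{k+1},X_{k+2},\dots)=a(X_{k-1}+X_{k+1})+b ,$$ and that $\rho\neq 0$ and $r_2+1-2|\rho|>0$. Then: (i) $r_k=\rho^{|k|}$ for all $k\in\mathbb{Z}$; (ii) one-sided regressions are also linear: $E(X_k\mid \dots,X_{-1},X_0)=r_kX_0$ for $k=1,2,\dots$.
   Context: $L_2$-stationary means that the variables are square-integrable, $E(X_k)$ does not depend on $k$, and $E(X_kX_{k+j})$ does not depend on $k$ for each $j$. The first conditional expectation is given the $\sigma$-field generated by $\{X_j: j\ne k\}$; $E(\cdot\mid\dots,X_{-1},X_0)$ is conditional expectation given the $\sigma$-field generated by $\{X_j:j\le 0\}$. Equalities of conditional expectations hold almost surely. *)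

theory Defs
  imports "HOL-Probability.Probability"
begin

definition covariance :: "'a measure \<Rightarrow> ('a \<Rightarrow> real) \<Rightarrow> ('a \<Rightarrow> real) \<Rightarrow> real" where
  "covariance M Y Z =
     (\<integral>\<omega>. (Y \<omega> - (\<integral>\<omega>'. Y \<omega>' \<partial>M)) * (Z \<omega> - (\<integral>\<omega>'. Z \<omega>' \<partial>M)) \<partial>M)"

definition correlation :: "'a measure \<Rightarrow> ('a \<Rightarrow> real) \<Rightarrow> ('a \<Rightarrow> real) \<Rightarrow> real" where
  "correlation M Y Z = covariance M Y Z / (sqrt (covariance M Y Y) * sqrt (covariance M Z Z))"

definition L2_stationary :: "'a measure \<Rightarrow> (int \<Rightarrow> 'a \<Rightarrow> real) \<Rightarrow> bool" where
  "L2_stationary M X \<longleftrightarrow>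
     (\<forall>k. X k \<in> borel_measurable M \<and> integrable M (\<lambda>\<omega>. (X k \<omega>)\<^sup>2)) \<and>
     (\<forall>k l. (\<integral>\<omega>. X k \<omega> \<partial>M) = (\<integral>\<omega>. X l \<omega> \<partial>M)) \<and>
     (\<forall>j k l. (\<integral>\<omega>. X k \<omega> * X (k + j) \<omega> \<partial>M) = (\<integral>\<omega>. X l \<omega> * X (l + j) \<omega> \<partial>M))"

(* The sigma-field generated by the variables X j, j in J. Only its space and its sets
   are relevant. *)
definition generated_by ::
    "'a measure \<Rightarrow> (int \<Rightarrow> 'a \<Rightarrow> real) \<Rightarrow> int set \<Rightarrow> 'a measure" where
  "generated_by M X J =
     sigma (space M) (\<Union>j\<in>J. {X j -` A \<inter> space M | A. A \<in> sets borel})"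

(* real_cond_exp M F is a conditional expectation only if F is a subalgebra of M. *)
lemma subalgebra_generated_by:
  assumes "\<And>j. j \<in> J \<Longrightarrow> X j \<in> borel_measurable M"
  shows "subalgebra M (generated_by M X J)"
proof -
  let ?G = "\<Union>j\<in>J. {X j -` A \<inter> space M | A. A \<in> sets borel}"
  have "?G \<subseteq> Pow (space M)"
    by auto
  moreover have "?G \<subseteq> sets M"
    using assms by (auto intro: measurable_sets)
  ultimately show ?thesis
    by (simp add: subalgebra_def generated_by_def space_measure_of sets_measure_of
        sets.sigma_sets_subset)
qed

end

theory Submission
  imports Defs
begin

text \<open>
  Everything is read off from one recurrence and its solutions bounded in \<open>L\<^sup>1\<close>.

  Write \<open>F\<close> for the past, generated by the \<open>X j\<close> with \<open>j \<le> 0\<close>, and \<open>Y n = E(X n | F)\<close>.  For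
  \<open>n \<ge> 1\<close> the index \<open>n\<close> is not among those generating \<open>F\<close>, so conditioning the two-sided
  regression of \<open>X n\<close> on \<open>F\<close> gives \<open>Y n = a (Y (n - 1) + Y (n + 1))\<close>; the constant \<open>b\<close> vanishes
  because all means are zero.  Multiplying the regression of \<open>X 1\<close> by \<open>X 0\<close> and integrating gives
  \<open>\<rho> = a (1 + r 2)\<close>, so \<open>a \<noteq> 0\<close>, and the hypothesis \<open>r 2 + 1 > 2 \<bar>\<rho>\<bar>\<close> gives \<open>\<bar>a\<bar> < 1/2\<close>.  The
  characteristic equation \<open>a (1 + q\<^sup>2) = q\<close> then has a real root with \<open>0 < \<bar>q\<bar> < 1\<close>, the other
  root being \<open>1/q\<close> (lemma \<open>contracting_characteristic_root\<close>).

  Solutions of the recurrence are combinations of \<open>q ^ n\<close> and \<open>(1/q) ^ n\<close> with random coefficients.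
  Conditional expectation contracts the \<open>L\<^sup>1\<close> norm, so the \<open>Y n\<close> are bounded in \<open>L\<^sup>1\<close>, and this
  excludes the growing component (lemma \<open>L1_bounded_recurrence_geometric\<close>).  Hence
  \<open>Y n = q ^ n X 0\<close> almost surely.  Multiplying by \<open>X 0\<close> and integrating yields
  \<open>E(X 0 X n) = q ^ n\<close>; in particular \<open>q = \<rho>\<close>, and both claims follow.
\<close>

section \<open>The \<sigma>-fields generated by part of the sequence\<close>

lemma subalgebra_generated_by_mono:
  assumes "J \<subseteq> K"
  shows "subalgebra (generated_by M X K) (generated_by M X J)"
proof -
  let ?G = "\<lambda>J. \<Union>j\<in>J. {X j -` A \<inter> space M | A. A \<in> sets borel}"
  have "sigma_sets (space M) (?G J) \<subseteq> sigma_sets (space M) (?G K)"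
    using assms by (intro sigma_sets_mono') blast
  moreover have "?G J \<subseteq> Pow (space M)" "?G K \<subseteq> Pow (space M)"
    by auto
  ultimately show ?thesis
    by (simp add: subalgebra_def generated_by_def space_measure_of sets_measure_of)
qed

lemma measurable_generated_by:
  assumes "j \<in> J"
  shows "X j \<in> borel_measurable (generated_by M X J)"
proof (rule measurableI)
  let ?G = "\<Union>j\<in>J. {X j -` A \<inter> space M | A. A \<in> sets borel}"
  have G: "?G \<subseteq> Pow (space M)"
    by auto
  fix A :: "real set"
  assume "A \<in> sets borel"
  then have "X j -` A \<inter> space M \<in> sigma_sets (space M) ?G"
    using assms by (intro sigma_sets.Basic) blast
  then show "X j -` A \<inter> space (generated_by M X J) \<in> sets (generated_by M X J)"
    using G by (simp add: generated_by_def space_measure_of sets_measure_of)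
qed simp

section \<open>Integrability and conditional expectation\<close>

lemma correlation_standardized:
  assumes "(\<integral>\<omega>. Y \<omega> \<partial>M) = 0" "(\<integral>\<omega>. Z \<omega> \<partial>M) = 0"
    and "(\<integral>\<omega>. (Y \<omega>)\<^sup>2 \<partial>M) = 1" "(\<integral>\<omega>. (Z \<omega>)\<^sup>2 \<partial>M) = 1"
  shows "correlation M Y Z = (\<integral>\<omega>. Y \<omega> * Z \<omega> \<partial>M)"
  using assms by (simp add: correlation_def covariance_def power2_eq_square)

lemma integrable_mult_of_squares:
  fixes f g :: "'a \<Rightarrow> real"
  assumes [measurable]: "f \<in> borel_measurable M" "g \<in> borel_measurable M"
    and "integrable M (\<lambda>x. (f x)\<^sup>2)" "integrable M (\<lambda>x. (g x)\<^sup>2)"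
  shows "integrable M (\<lambda>x. f x * g x)"
proof (rule Bochner_Integration.integrable_bound)
  show "integrable M (\<lambda>x. (f x)\<^sup>2 + (g x)\<^sup>2)"
    using assms by simp
  have "\<bar>s * t\<bar> \<le> s\<^sup>2 + t\<^sup>2" for s t :: real
  proof -
    have "2 * (\<bar>s\<bar> * \<bar>t\<bar>) \<le> s\<^sup>2 + t\<^sup>2"
      using sum_squares_bound[of "\<bar>s\<bar>" "\<bar>t\<bar>"] by simp
    moreover have "0 \<le> \<bar>s\<bar> * \<bar>t\<bar>" by simp
    ultimately show ?thesis unfolding abs_mult by linarith
  qed
  then show "AE x in M. norm (f x * g x) \<le> norm ((f x)\<^sup>2 + (g x)\<^sup>2)"
    by simp
qed measurable

lemma (in sigma_finite_subalgebra) real_cond_exp_L1_contraction: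
  assumes "integrable M f"
  shows "(\<integral>x. \<bar>real_cond_exp M F f x\<bar> \<partial>M) \<le> (\<integral>x. \<bar>f x\<bar> \<partial>M)"
proof -
  have abs_f: "integrable M (\<lambda>x. \<bar>f x\<bar>)" "integrable M (\<lambda>x. - \<bar>f x\<bar>)"
    using assms by auto
  have "AE x in M. real_cond_exp M F f x \<le> real_cond_exp M F (\<lambda>x. \<bar>f x\<bar>) x"
    using assms abs_f by (intro real_cond_exp_mono) auto
  moreover have "AE x in M. real_cond_exp M F (\<lambda>x. - \<bar>f x\<bar>) x \<le> real_cond_exp M F f x"
    using assms abs_f by (intro real_cond_exp_mono) auto
  moreover have "AE x in M. real_cond_exp M F (\<lambda>x. - \<bar>f x\<bar>) x = - real_cond_exp M F (\<lambda>x. \<bar>f x\<bar>) x"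
    using real_cond_exp_cmult[OF abs_f(1), of "-1"] by simp
  ultimately have "AE x in M. \<bar>real_cond_exp M F f x\<bar> \<le> real_cond_exp M F (\<lambda>x. \<bar>f x\<bar>) x"
    by eventually_elim linarith
  then have "(\<integral>x. \<bar>real_cond_exp M F f x\<bar> \<partial>M) \<le> (\<integral>x. real_cond_exp M F (\<lambda>x. \<bar>f x\<bar>) x \<partial>M)"
    using real_cond_exp_int(1)[OF assms] real_cond_exp_int(1)[OF abs_f(1)]
    by (intro integral_mono_AE) auto
  then show ?thesis
    using real_cond_exp_int(2)[OF abs_f(1)] by simp
qed

section \<open>The three-term recurrence\<close>

text \<open>The roots of \<open>a q\<^sup>2 - q + a\<close> have product 1, and for \<open>\<bar>a\<bar> < 1/2\<close> they are real and distinct,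
  so exactly one of them has absolute value below 1.\<close>

lemma contracting_characteristic_root:
  fixes a :: real
  assumes "a \<noteq> 0" "\<bar>a\<bar> < 1 / 2"
  obtains q where "q \<noteq> 0" "\<bar>q\<bar> < 1" "a * (1 + q\<^sup>2) = q"
proof -
  define s where "s = sqrt (1 - (2 * a)\<^sup>2)"
  have "(2 * a)\<^sup>2 < 1"
    using assms by (simp only: abs_square_less_1)
  then have s: "s\<^sup>2 = 1 - (2 * a)\<^sup>2" "0 < s"
    by (auto simp: s_def)
  \<comment> \<open>This form of the smaller root \<open>(1 - s) / (2 a)\<close> has denominator greater than 1.\<close>
  define q where "q = 2 * a / (1 + s)"
  have "q \<noteq> 0"
    using assms s by (simp add: q_def)
  moreover have "\<bar>q\<bar> < 1"
    using assms s by (simp add: q_def abs_div_pos[symmetric])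
  moreover have "a * (1 + q\<^sup>2) = q"
  proof -
    have "(1 + s)\<^sup>2 + (2 * a)\<^sup>2 = 2 * (1 + s)"
      using s by (simp add: power2_eq_square algebra_simps)
    then have "1 + q\<^sup>2 = 2 * (1 + s) / (1 + s)\<^sup>2"
      using s by (simp add: q_def power_divide add_divide_eq_iff)
    also have "\<dots> = 2 / (1 + s)"
      using s(2) by (simp add: frac_eq_eq power2_eq_square)
    finally show ?thesis
      by (simp add: q_def)
  qed
  ultimately show thesis
    by (rule that)
qed

text \<open>The differences \<open>D n = Y (n + 1) - q Y n\<close> isolate the growing component: the recurrence
  amounts to \<open>D n = q D (n + 1)\<close>.  Iterating, \<open>\<parallel>D 0\<parallel> = \<bar>q\<bar> ^ n \<parallel>D n\<parallel>\<close> in \<open>L\<^sup>1\<close>, which tends to zero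
  when the \<open>Y n\<close> are bounded in \<open>L\<^sup>1\<close>.\<close>

lemma L1_bounded_recurrence_geometric:
  fixes Y :: "nat \<Rightarrow> 'a \<Rightarrow> real"
  assumes q: "q \<noteq> 0" "\<bar>q\<bar> < 1" "a * (1 + q\<^sup>2) = q"
    and int: "\<And>n. integrable M (Y n)"
    and bound: "\<And>n. (\<integral>x. \<bar>Y n x\<bar> \<partial>M) \<le> C"
    and rec: "\<And>n. AE x in M. Y (Suc n) x = a * (Y n x + Y (Suc (Suc n)) x)"
  shows "AE x in M. Y n x = q ^ n * Y 0 x"
proof -
  define D where "D n x = Y (Suc n) x - q * Y n x" for n x
  have D_int: "integrable M (D n)" for n
    unfolding D_def using int by auto
  have D_step: "AE x in M. D n x = q * D (Suc n) x" for n
    using rec[of n]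
  proof eventually_elim
    case (elim x)
    have "(1 + q\<^sup>2) * Y (Suc n) x = (a * (1 + q\<^sup>2)) * (Y n x + Y (Suc (Suc n)) x)"
      unfolding elim by (simp only: mult_ac)
    then show ?case
      unfolding q(3) D_def by (simp add: algebra_simps power2_eq_square)
  qed
  have D_iter: "AE x in M. D 0 x = q ^ n * D n x" for n
  proof (induction n)
    case (Suc n)
    then show ?case
      using D_step[of n] by eventually_elim simp
  qed simp
  have D_bound: "(\<integral>x. \<bar>D n x\<bar> \<partial>M) \<le> 2 * C" for n
  proof -
    have "\<bar>D n x\<bar> \<le> \<bar>Y (Suc n) x\<bar> + \<bar>Y n x\<bar>" for x
    proof -
      have "\<bar>q * Y n x\<bar> \<le> \<bar>Y n x\<bar>"
        using q(2) by (simp add: abs_mult mult_left_le_one_le)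
      then show ?thesis
        unfolding D_def by linarith
    qed
    then have "(\<integral>x. \<bar>D n x\<bar> \<partial>M) \<le> (\<integral>x. \<bar>Y (Suc n) x\<bar> + \<bar>Y n x\<bar> \<partial>M)"
      using int D_int by (intro integral_mono) auto
    also have "\<dots> = (\<integral>x. \<bar>Y (Suc n) x\<bar> \<partial>M) + (\<integral>x. \<bar>Y n x\<bar> \<partial>M)"
      using int by (intro Bochner_Integration.integral_add) auto
    also have "\<dots> \<le> 2 * C"
      using bound[of n] bound[of "Suc n"] by simp
    finally show ?thesis .
  qed
  have "(\<integral>x. \<bar>D 0 x\<bar> \<partial>M) \<le> \<bar>q\<bar> ^ n * (2 * C)" for n
  proof -
    have "(\<integral>x. \<bar>D 0 x\<bar> \<partial>M) = (\<integral>x. \<bar>q\<bar> ^ n * \<bar>D n x\<bar> \<partial>M)"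
    proof (rule integral_cong_AE)
      show "AE x in M. \<bar>D 0 x\<bar> = \<bar>q\<bar> ^ n * \<bar>D n x\<bar>"
        using D_iter[of n] by eventually_elim (simp add: abs_mult power_abs)
    qed (use D_int in auto)
    also have "\<dots> \<le> \<bar>q\<bar> ^ n * (2 * C)"
      using D_bound[of n] by (simp add: mult_left_mono)
    finally show ?thesis .
  qed
  moreover have "(\<lambda>n. \<bar>q\<bar> ^ n * (2 * C)) \<longlonglongrightarrow> 0"
    using q(2) by (intro tendsto_mult_left_zero LIMSEQ_realpow_zero) auto
  ultimately have "(\<integral>x. \<bar>D 0 x\<bar> \<partial>M) \<le> 0"
    by (intro LIMSEQ_le_const) auto
  then have "(\<integral>x. \<bar>D 0 x\<bar> \<partial>M) = 0"
    by (simp add: antisym)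
  then have D0: "AE x in M. D 0 x = 0"
    using integral_nonneg_eq_0_iff_AE[of M "\<lambda>x. \<bar>D 0 x\<bar>"] D_int by simp
  have Y_step: "AE x in M. Y (Suc n) x = q * Y n x" for n
    using D0 D_iter[of n] by eventually_elim (use q(1) in \<open>simp add: D_def\<close>)
  show ?thesis
  proof (induction n)
    case (Suc n)
    then show ?case
      using Y_step[of n] by eventually_elim simp
  qed simp
qed

section \<open>Stationary sequences with linear two-sided regressions\<close>

theorem theorem3p1:
  fixes M :: "'a measure" and X :: "int \<Rightarrow> 'a \<Rightarrow> real"
    and r :: "int \<Rightarrow> real" and \<rho> a b :: real
  assumes "prob_space M"
    and "L2_stationary M X"
    and "\<And>k. (\<integral>\<omega>. X k \<omega> \<partial>M) = 0"
    and "\<And>k. (\<integral>\<omega>. (X k \<omega>)\<^sup>2 \<partial>M) = 1"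
    and "\<And>k. r k = correlation M (X 0) (X k)"
    and "\<rho> = r 1"
    and "\<And>k. AE \<omega> in M. real_cond_exp M (generated_by M X {j. j \<noteq> k}) (X k) \<omega>
                = a * (X (k - 1) \<omega> + X (k + 1) \<omega>) + b"
    and "\<rho> \<noteq> 0"
    and "r 2 + 1 - 2 * \<bar>\<rho>\<bar> > 0"
  shows "(\<forall>k. r k = \<rho> ^ nat \<bar>k\<bar>) \<and>
         (\<forall>k\<ge>1. AE \<omega> in M. real_cond_exp M (generated_by M X {j. j \<le> 0}) (X k) \<omega> = r k * X 0 \<omega>)"
proof -
  interpret prob_space M by fact
  note stationary = assms(2)[unfolded L2_stationary_def]
  have X_meas [measurable]: "X k \<in> borel_measurable M" for k
    using stationary by blast
  have X_sq: "integrable M (\<lambda>\<omega>. (X k \<omega>)\<^sup>2)" for k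
    using stationary by blast
  have X_prod: "integrable M (\<lambda>\<omega>. X k \<omega> * X l \<omega>)" for k l
    by (intro integrable_mult_of_squares X_meas X_sq)
  have X_int: "integrable M (X k)" for k
    using integrable_mult_of_squares[OF X_meas _ X_sq, of "\<lambda>_. 1" k] by simp
  have X_L1: "(\<integral>\<omega>. \<bar>X k \<omega>\<bar> \<partial>M) \<le> 1" for k
  proof -
    have "(\<integral>\<omega>. \<bar>X k \<omega>\<bar> \<partial>M) \<le> (\<integral>\<omega>. (1 + (X k \<omega>)\<^sup>2) / 2 \<partial>M)"
    proof (rule integral_mono)
      show "\<bar>X k \<omega>\<bar> \<le> (1 + (X k \<omega>)\<^sup>2) / 2" for \<omega>
        using sum_squares_bound[of 1 "\<bar>X k \<omega>\<bar>"] by simp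
    qed (use X_int X_sq in auto)
    also have "\<dots> = 1"
      using X_sq assms(4)[of k] by (simp add: prob_space)
    finally show ?thesis .
  qed
  have r_eq: "r k = (\<integral>\<omega>. X 0 \<omega> * X k \<omega> \<partial>M)" for k
    unfolding assms(5) by (intro correlation_standardized assms(3,4))

  define G where "G k = generated_by M X {j. j \<noteq> k}" for k
  define F where "F = generated_by M X {j. j \<le> 0}"
  have G_sub: "subalgebra M (G k)" for k
    unfolding G_def by (intro subalgebra_generated_by X_meas)
  have F_sub: "subalgebra M F"
    unfolding F_def by (intro subalgebra_generated_by X_meas)
  have FG_sub: "subalgebra (G k) F" if "k \<ge> 1" for k
    unfolding F_def G_def using that by (intro subalgebra_generated_by_mono) auto
  have X0_F: "X 0 \<in> borel_measurable F"
    unfolding F_def by (intro measurable_generated_by) simp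
  interpret F: finite_measure_subalgebra M F
    by unfold_locales (rule F_sub)
  interpret G: finite_measure_subalgebra M "G k" for k
    by unfold_locales (rule G_sub)
  have regression: "AE \<omega> in M. real_cond_exp M (G k) (X k) \<omega> = a * (X (k - 1) \<omega> + X (k + 1) \<omega>) + b" for k
    unfolding G_def by (rule assms(7))

  have "b = 0"
  proof -
    have "(\<integral>\<omega>. X 0 \<omega> \<partial>M) = (\<integral>\<omega>. real_cond_exp M (G 0) (X 0) \<omega> \<partial>M)"
      using G.real_cond_exp_int(2)[OF X_int] by simp
    also have "\<dots> = (\<integral>\<omega>. a * (X (- 1) \<omega> + X 1 \<omega>) + b \<partial>M)"
      using regression[of 0] by (intro integral_cong_AE) auto
    also have "\<dots> = b"
      using X_int assms(3) by (simp add: prob_space)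
    finally show ?thesis
      using assms(3) by simp
  qed

  have rho_eq: "\<rho> = a * (1 + r 2)"
  proof -
    have X0_G: "X 0 \<in> borel_measurable (G 1)"
      unfolding G_def by (intro measurable_generated_by) simp
    have "\<rho> = (\<integral>\<omega>. X 0 \<omega> * real_cond_exp M (G 1) (X 1) \<omega> \<partial>M)"
      unfolding assms(6) r_eq
      by (intro G.real_cond_exp_intg(2)[symmetric] X_prod X0_G X_meas)
    also have "\<dots> = (\<integral>\<omega>. a * ((X 0 \<omega>)\<^sup>2 + X 0 \<omega> * X 2 \<omega>) \<partial>M)"
    proof (rule integral_cong_AE)
      show "AE \<omega> in M. X 0 \<omega> * real_cond_exp M (G 1) (X 1) \<omega> = a * ((X 0 \<omega>)\<^sup>2 + X 0 \<omega> * X 2 \<omega>)"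
        using regression[of 1]
        by eventually_elim (simp add: \<open>b = 0\<close> power2_eq_square algebra_simps)
    qed simp_all
    also have "\<dots> = a * (1 + r 2)"
      using X_sq X_prod assms(4) by (simp add: r_eq)
    finally show ?thesis .
  qed

  have "a \<noteq> 0"
    using rho_eq assms(8) by auto
  moreover have "\<bar>a\<bar> < 1 / 2"
  proof -
    have pos: "1 + r 2 > 0"
      using assms(9) by linarith
    then have "\<bar>\<rho>\<bar> = \<bar>a\<bar> * (1 + r 2)"
      by (simp add: rho_eq abs_mult)
    then have "2 * \<bar>a\<bar> * (1 + r 2) = 2 * \<bar>\<rho>\<bar>"
      by (simp only: mult.assoc)
    then have "2 * \<bar>a\<bar> * (1 + r 2) < 1 * (1 + r 2)"
      using assms(9) by (simp only: mult_1)
    then have "2 * \<bar>a\<bar> < 1"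
      using pos by (rule mult_right_less_imp_less[OF _ less_imp_le])
    then show ?thesis
      by simp
  qed
  ultimately obtain q where q: "q \<noteq> 0" "\<bar>q\<bar> < 1" "a * (1 + q\<^sup>2) = q"
    by (rule contracting_characteristic_root)

  define Y where "Y n = real_cond_exp M F (X (int n))" for n
  have Y_rec: "AE \<omega> in M. Y (Suc n) \<omega> = a * (Y n \<omega> + Y (Suc (Suc n)) \<omega>)" for n
  proof -
    let ?k = "int (Suc n)"
    let ?S = "\<lambda>\<omega>. X (int n) \<omega> + X (int (Suc (Suc n))) \<omega>"
    have S_int: "integrable M ?S"
      using X_int by simp
    have tower: "AE \<omega> in M. real_cond_exp M F (real_cond_exp M (G ?k) (X ?k)) \<omega> = Y (Suc n) \<omega>"
      unfolding Y_def by (intro F.real_cond_exp_nested_subalg G_sub FG_sub X_int) simp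
    have inner: "AE \<omega> in M. real_cond_exp M F (real_cond_exp M (G ?k) (X ?k)) \<omega>
        = real_cond_exp M F (\<lambda>\<omega>. a * ?S \<omega>) \<omega>"
    proof (rule F.real_cond_exp_cong)
      have "?k - 1 = int n" "?k + 1 = int (Suc (Suc n))"
        by auto
      then show "AE \<omega> in M. real_cond_exp M (G ?k) (X ?k) \<omega> = a * ?S \<omega>"
        using regression[of ?k] by (simp only: \<open>b = 0\<close> add_0_right)
    qed simp_all
    have scale: "AE \<omega> in M. real_cond_exp M F (\<lambda>\<omega>. a * ?S \<omega>) \<omega> = a * real_cond_exp M F ?S \<omega>"
      by (rule F.real_cond_exp_cmult[OF S_int])
    have split: "AE \<omega> in M. real_cond_exp M F ?S \<omega> = Y n \<omega> + Y (Suc (Suc n)) \<omega>"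
      unfolding Y_def by (intro F.real_cond_exp_add X_int)
    show ?thesis
      using tower inner scale split by eventually_elim simp
  qed
  have Y_L1: "(\<integral>\<omega>. \<bar>Y n \<omega>\<bar> \<partial>M) \<le> 1" for n
    unfolding Y_def using F.real_cond_exp_L1_contraction[OF X_int] X_L1 by (rule order_trans)
  have Y_int: "integrable M (Y n)" for n
    unfolding Y_def by (intro F.real_cond_exp_int X_int)
  have "AE \<omega> in M. Y 0 \<omega> = X 0 \<omega>"
    unfolding Y_def using F.real_cond_exp_F_meas[OF X_int X0_F] by simp
  then have Y_geometric: "AE \<omega> in M. Y n \<omega> = q ^ n * X 0 \<omega>" for n
    using L1_bounded_recurrence_geometric[where Y = Y and n = n, OF q Y_int Y_L1 Y_rec]
    by eventually_elim simp

  have r_nat: "r (int n) = q ^ n" for n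
  proof -
    have "r (int n) = (\<integral>\<omega>. X 0 \<omega> * Y n \<omega> \<partial>M)"
      unfolding r_eq Y_def
      by (intro F.real_cond_exp_intg(2)[symmetric] X_prod X0_F X_meas)
    also have "\<dots> = (\<integral>\<omega>. q ^ n * (X 0 \<omega>)\<^sup>2 \<partial>M)"
    proof (rule integral_cong_AE)
      show "AE \<omega> in M. X 0 \<omega> * Y n \<omega> = q ^ n * (X 0 \<omega>)\<^sup>2"
        using Y_geometric[of n] by eventually_elim (simp add: power2_eq_square)
    qed (use Y_int in auto)
    also have "\<dots> = q ^ n"
      using assms(4) by simp
    finally show ?thesis .
  qed
  have "\<rho> = q"
    using r_nat[of 1] assms(6) by simp
  have r_minus: "r (- k) = r k" for k
  proof -
    have "(\<integral>\<omega>. X (- k) \<omega> * X (- k + k) \<omega> \<partial>M) = (\<integral>\<omega>. X 0 \<omega> * X (0 + k) \<omega> \<partial>M)"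
      using stationary by blast
    then show ?thesis
      by (simp add: r_eq mult.commute)
  qed
  have "r k = \<rho> ^ nat \<bar>k\<bar>" for k
  proof (cases "k \<ge> 0")
    case True
    then show ?thesis
      using r_nat[of "nat k"] \<open>\<rho> = q\<close> by simp
  next
    case False
    then show ?thesis
      using r_nat[of "nat (- k)"] r_minus[of k] \<open>\<rho> = q\<close> by simp
  qed
  moreover have "AE \<omega> in M. real_cond_exp M F (X k) \<omega> = r k * X 0 \<omega>" if "k \<ge> 1" for k
  proof -
    have "int (nat k) = k"
      using that by simp
    then show ?thesis
      using Y_geometric[of "nat k"] r_nat[of "nat k"] by (simp add: Y_def)
  qed
  ultimately show ?thesis
    unfolding F_def by blast
qed

end
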